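(* Let $T$ be a complete first-order theory. Then $T$ has $\mathsf{SOP}_{\Sigma_{\mathrm{op}}}$ if and only if $T$ has the order property $\mathsf{OP}$.
   Context: Work in a monster model $\mathfrak U$ of $T$; variables are finite tuples. For a class $\mathcal K$ of finite posets, a partitioned formula $\psi(x;y)$ has $\mathsf{SOP}_{\mathcal K}$ iff for every $(\sigma,\le)\in\mathcal K$ there are $(d^s\mid s\in\sigma)$ in $\mathfrak U^{|y|}$ such that $\mathfrak U\models\forall x\,(\psi(x;d^{s_0})\rightarrow\psi(x;d^{s_1}))$ iff $\sigma\models s_0\le s_1$; $T$ has $\mathsf{SOP}_{\mathcal K}$ iff some partitioned formula does. For a poset $\Sigma$, $\mathsf{SOP}_\Sigma$ means $\mathsf{SOP}_{\mathrm{age}(\Sigma)}$, where $\mathrm{age}(\Sigma)$ is the class of finite posets embeddable in $\Sigma$. $\Sigma_{\mathrm{op}}$ is the poset with domain $\{\alpha_i\mid i<\omega\}\cup\{\beta_j\mid j<\omega\}$ (all distinct) whose only strict relations are $\alpha_i<\beta_j$ for $i<j$. $T$ has $\mathsf{OP}$ iff there are a partitioned formula $\phi(x;y)$ and tuples $(a^i)_{i<\omega}$, $(b^j)_{j<\omega}$ in $\mathfrak U$ with $\mathfrak U\models\phi(a^i;b^j)\iff i<j$. *)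

theory Defs
  imports Main
begin

section \<open>First-order logic with equality\<close>

record ('f, 'r) language =
  funs :: "'f set"
  rels :: "'r set"
  fun_arity :: "'f \<Rightarrow> nat"
  rel_arity :: "'r \<Rightarrow> nat"

datatype 'f tm = Var nat | Fn 'f "'f tm list"

datatype ('f, 'r) form =
    Falsum
  | Eq "'f tm" "'f tm"
  | Rel 'r "'f tm list"
  | Imp "('f, 'r) form" "('f, 'r) form"
  | Forall nat "('f, 'r) form"

abbreviation Neg :: "('f, 'r) form \<Rightarrow> ('f, 'r) form" where
  "Neg \<phi> \<equiv> Imp \<phi> Falsum"

primrec tm_vars :: "'f tm \<Rightarrow> nat set" where
  "tm_vars (Var v) = {v}"
| "tm_vars (Fn f ts) = \<Union> (set (map tm_vars ts))"

primrec free_vars :: "('f, 'r) form \<Rightarrow> nat set" where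
  "free_vars Falsum = {}"
| "free_vars (Eq t u) = tm_vars t \<union> tm_vars u"
| "free_vars (Rel r ts) = \<Union> (set (map tm_vars ts))"
| "free_vars (Imp \<phi> \<psi>) = free_vars \<phi> \<union> free_vars \<psi>"
| "free_vars (Forall v \<phi>) = free_vars \<phi> - {v}"

primrec wf_tm :: "('f, 'r) language \<Rightarrow> 'f tm \<Rightarrow> bool" where
  "wf_tm L (Var v) \<longleftrightarrow> True"
| "wf_tm L (Fn f ts) \<longleftrightarrow> f \<in> funs L \<and> length ts = fun_arity L f \<and> list_all (wf_tm L) ts"

primrec wf_form :: "('f, 'r) language \<Rightarrow> ('f, 'r) form \<Rightarrow> bool" where
  "wf_form L Falsum \<longleftrightarrow> True"
| "wf_form L (Eq t u) \<longleftrightarrow> wf_tm L t \<and> wf_tm L u"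
| "wf_form L (Rel r ts) \<longleftrightarrow> r \<in> rels L \<and> length ts = rel_arity L r \<and> list_all (wf_tm L) ts"
| "wf_form L (Imp \<phi> \<psi>) \<longleftrightarrow> wf_form L \<phi> \<and> wf_form L \<psi>"
| "wf_form L (Forall v \<phi>) \<longleftrightarrow> wf_form L \<phi>"

definition formulas :: "('f, 'r) language \<Rightarrow> ('f, 'r) form set" where
  "formulas L = {\<phi>. wf_form L \<phi>}"

definition sentences :: "('f, 'r) language \<Rightarrow> ('f, 'r) form set" where
  "sentences L = {\<phi> \<in> formulas L. free_vars \<phi> = {}}"

record ('f, 'r, 'a) fo_struct =
  univ :: "'a set"
  fun_int :: "'f \<Rightarrow> 'a list \<Rightarrow> 'a"
  rel_int :: "'r \<Rightarrow> 'a list \<Rightarrow> bool"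

definition tuples :: "('f, 'r, 'a) fo_struct \<Rightarrow> nat \<Rightarrow> 'a list set" where
  "tuples M n = {as. length as = n \<and> set as \<subseteq> univ M}"

definition is_struct :: "('f, 'r) language \<Rightarrow> ('f, 'r, 'a) fo_struct \<Rightarrow> bool" where
  "is_struct L M \<longleftrightarrow> univ M \<noteq> {} \<and>
     (\<forall>f \<in> funs L. \<forall>as \<in> tuples M (fun_arity L f). fun_int M f as \<in> univ M)"

primrec eval_tm :: "('f, 'r, 'a) fo_struct \<Rightarrow> (nat \<Rightarrow> 'a) \<Rightarrow> 'f tm \<Rightarrow> 'a" where
  "eval_tm M s (Var v) = s v"
| "eval_tm M s (Fn f ts) = fun_int M f (map (eval_tm M s) ts)"

primrec sat :: "('f, 'r, 'a) fo_struct \<Rightarrow> (nat \<Rightarrow> 'a) \<Rightarrow> ('f, 'r) form \<Rightarrow> bool" where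
  "sat M s Falsum \<longleftrightarrow> False"
| "sat M s (Eq t u) \<longleftrightarrow> eval_tm M s t = eval_tm M s u"
| "sat M s (Rel r ts) \<longleftrightarrow> rel_int M r (map (eval_tm M s) ts)"
| "sat M s (Imp \<phi> \<psi>) \<longleftrightarrow> (sat M s \<phi> \<longrightarrow> sat M s \<psi>)"
| "sat M s (Forall v \<phi>) \<longleftrightarrow> (\<forall>a \<in> univ M. sat M (s(v := a)) \<phi>)"

definition true_in :: "('f, 'r, 'a) fo_struct \<Rightarrow> ('f, 'r) form \<Rightarrow> bool" where
  "true_in M \<phi> \<longleftrightarrow> (\<forall>s. range s \<subseteq> univ M \<longrightarrow> sat M s \<phi>)"

definition is_model ::
  "('f, 'r) language \<Rightarrow> ('f, 'r) form set \<Rightarrow> ('f, 'r, 'a) fo_struct \<Rightarrow> bool" where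
  "is_model L T M \<longleftrightarrow> is_struct L M \<and> (\<forall>\<phi> \<in> T. true_in M \<phi>)"


section \<open>Complete theories\<close>

text \<open>
  A formula of HOL cannot quantify over types, so the models in \<open>entails\<close> are those
  with universe inside the type of formulas. By the downward Loewenheim-Skolem theorem
  this is no restriction: see \<open>entails_model\<close> below.
\<close>

definition entails ::
  "('f, 'r) language \<Rightarrow> ('f, 'r) form set \<Rightarrow> ('f, 'r) form \<Rightarrow> bool" where
  "entails L T \<phi> \<longleftrightarrow>
     (\<forall>M :: ('f, 'r, ('f, 'r) form) fo_struct. is_model L T M \<longrightarrow> true_in M \<phi>)"

definition complete_theory :: "('f, 'r) language \<Rightarrow> ('f, 'r) form set \<Rightarrow> bool" where
  "complete_theory L T \<longleftrightarrow> T \<subseteq> sentences L \<and> \<not> entails L T Falsum \<and>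
     (\<forall>\<phi> \<in> sentences L. entails L T \<phi> \<or> entails L T (Neg \<phi>))"

lemma eval_tm_cong:
  "(\<And>v. v \<in> tm_vars t \<Longrightarrow> s v = s' v) \<Longrightarrow> eval_tm M s t = eval_tm M s' t"
proof (induction t)
  case (Fn f ts)
  then have "map (eval_tm M s) ts = map (eval_tm M s') ts" by auto
  then show ?case by (simp only: eval_tm.simps)
qed simp

lemma sat_cong:
  "(\<And>v. v \<in> free_vars \<phi> \<Longrightarrow> s v = s' v) \<Longrightarrow> sat M s \<phi> \<longleftrightarrow> sat M s' \<phi>"
proof (induction \<phi> arbitrary: s s')
  case (Eq t u)
  then show ?case using eval_tm_cong[of t s s' M] eval_tm_cong[of u s s' M] by simp
next
  case (Rel r ts)
  have "map (eval_tm M s) ts = map (eval_tm M s') ts"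
    using Rel by (auto intro!: eval_tm_cong)
  then show ?case by (simp only: sat.simps)
next
  case (Imp \<phi> \<psi>)
  have "sat M s \<phi> \<longleftrightarrow> sat M s' \<phi>" by (rule Imp.IH(1)) (use Imp.prems in auto)
  moreover have "sat M s \<psi> \<longleftrightarrow> sat M s' \<psi>" by (rule Imp.IH(2)) (use Imp.prems in auto)
  ultimately show ?case by simp
next
  case (Forall v \<phi>)
  have "sat M (s(v := a)) \<phi> \<longleftrightarrow> sat M (s'(v := a)) \<phi>" for a
    by (rule Forall.IH) (use Forall.prems in auto)
  then show ?case by simp
qed simp

lemma finite_tm_vars: "finite (tm_vars t)"
  by (induction t) auto

lemma finite_free_vars: "finite (free_vars \<phi>)"
  by (induction \<phi>) (auto simp: finite_tm_vars)

text \<open>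
  The first component enumerates a Skolem hull by formulas; the second reads
  \<open>Imp \<gamma>\<^sub>1 (Imp \<gamma>\<^sub>2 \<dots> Falsum)\<close> as the list of the elements
  that \<open>\<gamma>\<^sub>1, \<gamma>\<^sub>2, \<dots>\<close> stand for.
\<close>

primrec hull :: "(('f, 'r) form \<Rightarrow> 'a list \<Rightarrow> 'a) \<Rightarrow> 'a \<Rightarrow> ('f, 'r) form \<Rightarrow> 'a \<times> 'a list" where
  "hull W a\<^sub>0 Falsum = (a\<^sub>0, [])"
| "hull W a\<^sub>0 (Eq t u) = (a\<^sub>0, [])"
| "hull W a\<^sub>0 (Rel r ts) = (a\<^sub>0, [])"
| "hull W a\<^sub>0 (Imp \<phi> \<psi>) = (W \<phi> (snd (hull W a\<^sub>0 \<psi>)), fst (hull W a\<^sub>0 \<phi>) # snd (hull W a\<^sub>0 \<psi>))"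
| "hull W a\<^sub>0 (Forall v \<phi>) = (a\<^sub>0, [])"

lemma hull_closed:
  assumes "set as \<subseteq> range (fst \<circ> hull W a\<^sub>0)"
  shows "W \<phi> as \<in> range (fst \<circ> hull W a\<^sub>0)"
proof -
  have "\<exists>\<gamma>. snd (hull W a\<^sub>0 \<gamma>) = as" using assms
  proof (induction as)
    case Nil
    show ?case by (rule exI[of _ Falsum]) simp
  next
    case (Cons a as)
    then obtain \<gamma> \<delta> where "snd (hull W a\<^sub>0 \<gamma>) = as" "fst (hull W a\<^sub>0 \<delta>) = a" by auto
    then show ?case by (intro exI[of _ "Imp \<delta> \<gamma>"]) simp
  qed
  then obtain \<gamma> where "snd (hull W a\<^sub>0 \<gamma>) = as" by blast
  then have "(fst \<circ> hull W a\<^sub>0) (Imp \<phi> \<gamma>) = W \<phi> as" by simp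
  then show ?thesis by (metis rangeI)
qed

theorem downward_Loewenheim_Skolem:
  fixes M :: "('f, 'r, 'a) fo_struct"
  assumes M: "is_struct L M"
  obtains N :: "('f, 'r, ('f, 'r) form) fo_struct"
  where "is_struct L N" "\<And>\<phi>. \<phi> \<in> sentences L \<Longrightarrow> true_in N \<phi> \<longleftrightarrow> true_in M \<phi>"
proof -
  obtain a\<^sub>0 where a0: "a\<^sub>0 \<in> univ M" using M by (auto simp: is_struct_def)
  define asg where "asg as = (\<lambda>v. if v < length as then as ! v else a\<^sub>0)" for as
  define bad where "bad \<phi> as a \<longleftrightarrow> a \<in> univ M \<and>
    (\<exists>v \<psi>. \<phi> = Forall v \<psi> \<and> \<not> sat M ((asg as)(v := a)) \<psi>)" for \<phi> :: "('f, 'r) form" and as a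
  define W where "W \<phi> as = (if \<exists>a. bad \<phi> as a then SOME a. bad \<phi> as a else a\<^sub>0)" for \<phi> as
  define g where "g = fst \<circ> hull W a\<^sub>0"
  define H where "H = range g"
  have W_bad: "bad \<phi> as (W \<phi> as)" if "bad \<phi> as a" for \<phi> as a
    using that by (auto simp: W_def intro: someI)
  have W_univ: "W \<phi> as \<in> univ M" for \<phi> as
    using W_bad[of \<phi> as] a0 by (cases "\<exists>a. bad \<phi> as a") (auto simp: bad_def W_def)
  have g_univ: "g \<gamma> \<in> univ M" for \<gamma>
    by (cases \<gamma>) (auto simp: g_def a0 W_univ)
  have H_closed: "W \<phi> as \<in> H" if "set as \<subseteq> H" for \<phi> as
    using that hull_closed[of as W a\<^sub>0] by (simp add: H_def g_def)
  have H_univ: "H \<subseteq> univ M" using g_univ by (auto simp: H_def)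
  have witness: "\<exists>a \<in> H. \<not> sat M (t(v := a)) \<psi>"
    if t: "range t \<subseteq> H" and a: "a \<in> univ M" "\<not> sat M (t(v := a)) \<psi>" for t v a \<psi>
  proof -
    obtain n where n: "\<And>u. u \<in> free_vars \<psi> \<Longrightarrow> u < n"
      using finite_free_vars[of \<psi>] by (meson finite_nat_set_iff_bounded)
    define as where "as = map t [0..<n]"
    have eq: "sat M ((asg as)(v := b)) \<psi> \<longleftrightarrow> sat M (t(v := b)) \<psi>" for b
      by (rule sat_cong) (use n in \<open>auto simp: asg_def as_def\<close>)
    have "bad (Forall v \<psi>) as a" using a eq by (auto simp: bad_def)
    from W_bad[OF this] have "\<not> sat M (t(v := W (Forall v \<psi>) as)) \<psi>"
      using eq by (auto simp: bad_def)
    moreover have "W (Forall v \<psi>) as \<in> H"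
      by (rule H_closed) (use t in \<open>auto simp: as_def\<close>)
    ultimately show ?thesis by blast
  qed
  have H_fun: "fun_int M f as \<in> H"
    if f: "f \<in> funs L" "length as = fun_arity L f" and as: "set as \<subseteq> H" for f as
  proof -
    define n where "n = length as"
    define ts :: "'f tm list" where "ts = map Var [0..<n]"
    define t where "t = (\<lambda>v. if v < n then as ! v else g Falsum)"
    have t: "range t \<subseteq> H" using as by (auto simp: t_def n_def H_def)
    have ev: "map (eval_tm M (t(n := b))) ts = as" for b
      by (rule nth_equalityI) (auto simp: ts_def t_def n_def)
    have sat: "sat M (t(n := b)) (Neg (Eq (Fn f ts) (Var n))) \<longleftrightarrow> fun_int M f as \<noteq> b" for b
      using ev[of b] by simp
    have "fun_int M f as \<in> univ M"
      using M f as H_univ by (auto simp: is_struct_def tuples_def)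
    from witness[OF t this, of n "Neg (Eq (Fn f ts) (Var n))"] sat show ?thesis by blast
  qed
  define c where "c = inv g"
  have gc: "g (c a) = a" if "a \<in> H" for a
    using that by (simp add: c_def H_def f_inv_into_f)
  define N :: "('f, 'r, ('f, 'r) form) fo_struct" where
    "N = \<lparr>univ = c ` H, fun_int = (\<lambda>f as. c (fun_int M f (map g as))),
          rel_int = (\<lambda>r as. rel_int M r (map g as))\<rparr>"
  have N: "univ N = c ` H" "fun_int N = (\<lambda>f as. c (fun_int M f (map g as)))"
    "rel_int N = (\<lambda>r as. rel_int M r (map g as))" by (simp_all add: N_def)
  have gN: "g x \<in> H" for x by (simp add: H_def)
  have strN: "is_struct L N"
    unfolding is_struct_def
  proof (intro conjI ballI)
    show "univ N \<noteq> {}" by (simp add: N H_def)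
    fix f as assume "f \<in> funs L" "as \<in> tuples N (fun_arity L f)"
    then show "fun_int N f as \<in> univ N"
      using H_fun[of f "map g as"] gN by (auto simp: N tuples_def)
  qed
  have ev: "eval_tm N s t \<in> univ N \<and> g (eval_tm N s t) = eval_tm M (\<lambda>v. g (s v)) t"
    if "range s \<subseteq> univ N" "wf_tm L t" for s t
    using that(2)
  proof (induction t)
    case (Var v)
    then show ?case using that(1) by auto
  next
    case (Fn f ts)
    then have IH: "map g (map (eval_tm N s) ts) = map (eval_tm M (\<lambda>v. g (s v))) ts"
      by (auto simp: list_all_iff)
    have "set (map (eval_tm M (\<lambda>v. g (s v))) ts) \<subseteq> H"
      unfolding IH[symmetric] using gN by auto
    then have H: "fun_int M f (map (eval_tm M (\<lambda>v. g (s v))) ts) \<in> H"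
      by (intro H_fun) (use Fn.prems in auto)
    have "eval_tm N s (Fn f ts) = c (fun_int M f (map (eval_tm M (\<lambda>v. g (s v))) ts))"
      unfolding eval_tm.simps N IH by (rule refl)
    with H gc[OF H] show ?case by (auto simp: N(1))
  qed
  have inj: "x = y \<longleftrightarrow> g x = g y" if "x \<in> univ N" "y \<in> univ N" for x y
    using that gc by (auto simp: N)
  have sat: "sat N s \<phi> \<longleftrightarrow> sat M (\<lambda>v. g (s v)) \<phi>" if "range s \<subseteq> univ N" "wf_form L \<phi>" for s \<phi>
    using that
  proof (induction \<phi> arbitrary: s)
    case (Eq t u)
    then show ?case using ev[of s t] ev[of s u] inj by auto
  next
    case (Rel r ts)
    then have "map g (map (eval_tm N s) ts) = map (eval_tm M (\<lambda>v. g (s v))) ts"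
      using ev[of s] by (auto simp: list_all_iff)
    then show ?case unfolding sat.simps N by (simp only:)
  next
    case (Forall v \<phi>)
    have "sat N (s(v := x)) \<phi> \<longleftrightarrow> sat M ((\<lambda>v. g (s v))(v := g x)) \<phi>" if "x \<in> univ N" for x
    proof -
      have "sat N (s(v := x)) \<phi> \<longleftrightarrow> sat M (\<lambda>u. g ((s(v := x)) u)) \<phi>"
        by (rule Forall.IH) (use Forall.prems that in auto)
      also have "(\<lambda>u. g ((s(v := x)) u)) = (\<lambda>v. g (s v))(v := g x)" by auto
      finally show ?thesis .
    qed
    moreover have "g ` univ N = H" using gc by (force simp: N)
    ultimately have "sat N s (Forall v \<phi>) \<longleftrightarrow> (\<forall>a \<in> H. sat M ((\<lambda>v. g (s v))(v := a)) \<phi>)"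
      by auto
    also have "\<dots> \<longleftrightarrow> sat M (\<lambda>v. g (s v)) (Forall v \<phi>)"
    proof -
      have "range (\<lambda>v. g (s v)) \<subseteq> H" using gN by auto
      from witness[OF this, of _ v \<phi>] show ?thesis using H_univ by auto
    qed
    finally show ?case .
  qed simp_all
  have "true_in N \<phi> \<longleftrightarrow> true_in M \<phi>" if \<phi>: "\<phi> \<in> sentences L" for \<phi>
  proof -
    have fvN: "sat N s \<phi> \<longleftrightarrow> sat N s' \<phi>" for s s'
      using sat_cong[of \<phi> s s' N] \<phi> by (simp add: sentences_def)
    have fvM: "sat M s \<phi> \<longleftrightarrow> sat M s' \<phi>" for s s'
      using sat_cong[of \<phi> s s' M] \<phi> by (simp add: sentences_def)
    define s where "s = (\<lambda>_ :: nat. c (g Falsum))"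
    have s: "range s \<subseteq> univ N" by (auto simp: s_def N H_def)
    have "range (\<lambda>v. g (s v)) \<subseteq> univ M" using g_univ by auto
    then have "true_in M \<phi> \<longleftrightarrow> sat M (\<lambda>v. g (s v)) \<phi>" using fvM unfolding true_in_def by blast
    moreover have "true_in N \<phi> \<longleftrightarrow> sat N s \<phi>" using fvN s unfolding true_in_def by blast
    ultimately show ?thesis using sat[OF s] \<phi> by (simp add: sentences_def formulas_def)
  qed
  with strN show thesis by (rule that)
qed

corollary entails_model:
  fixes M :: "('f, 'r, 'a) fo_struct"
  assumes "T \<subseteq> sentences L" "\<phi> \<in> sentences L" "entails L T \<phi>" "is_model L T M"
  shows "true_in M \<phi>"
proof -
  from assms(4) have "is_struct L M" by (simp add: is_model_def)
  then obtain N :: "('f, 'r, ('f, 'r) form) fo_struct" where N: "is_struct L N"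
    "\<And>\<phi>. \<phi> \<in> sentences L \<Longrightarrow> true_in N \<phi> \<longleftrightarrow> true_in M \<phi>"
    by (rule downward_Loewenheim_Skolem) blast
  then have "is_model L T N" using assms(1,4) by (auto simp: is_model_def)
  then show ?thesis using N assms(2,3) by (auto simp: entails_def)
qed


section \<open>Monster models\<close>

text \<open>
  In a set \<open>p\<close> of formulas over \<open>A\<close> in the variables \<open>0, \<dots>, n - 1\<close>, a member
  is a pair \<open>(\<phi>, s)\<close>: the formula \<open>\<phi>\<close> with each free variable \<open>v \<ge> n\<close> replaced by
  the parameter \<open>s v \<in> A\<close>.
\<close>

definition formulas_over ::
  "('f, 'r) language \<Rightarrow> 'a set \<Rightarrow> nat \<Rightarrow> (('f, 'r) form \<times> (nat \<Rightarrow> 'a)) set" where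
  "formulas_over L A n =
     {(\<phi>, s). \<phi> \<in> formulas L \<and> (\<forall>v \<in> free_vars \<phi>. n \<le> v \<longrightarrow> s v \<in> A)}"

definition realizes ::
  "('f, 'r, 'a) fo_struct \<Rightarrow> 'a list \<Rightarrow> (('f, 'r) form \<times> (nat \<Rightarrow> 'a)) set \<Rightarrow> bool" where
  "realizes M as p \<longleftrightarrow>
     (\<forall>(\<phi>, s) \<in> p. sat M (\<lambda>v. if v < length as then as ! v else s v) \<phi>)"

definition saturated ::
  "('f, 'r) language \<Rightarrow> 'k rel \<Rightarrow> ('f, 'r, 'a) fo_struct \<Rightarrow> bool" where
  "saturated L \<kappa> M \<longleftrightarrow>
     (\<forall>A n p. A \<subseteq> univ M \<longrightarrow> (card_of A, \<kappa>) \<in> ordLess \<longrightarrow> p \<subseteq> formulas_over L A n \<longrightarrow>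
        (\<forall>q \<subseteq> p. finite q \<longrightarrow> (\<exists>as \<in> tuples M n. realizes M as q)) \<longrightarrow>
        (\<exists>as \<in> tuples M n. realizes M as p))"

definition elementary_map ::
  "('f, 'r) language \<Rightarrow> ('f, 'r, 'a) fo_struct \<Rightarrow> 'a set \<Rightarrow> ('a \<Rightarrow> 'a) \<Rightarrow> bool" where
  "elementary_map L M A h \<longleftrightarrow> A \<subseteq> univ M \<and> h ` A \<subseteq> univ M \<and>
     (\<forall>\<phi> \<in> formulas L. \<forall>s. (\<forall>v \<in> free_vars \<phi>. s v \<in> A) \<longrightarrow>
        (sat M s \<phi> \<longleftrightarrow> sat M (h \<circ> s) \<phi>))"

definition automorphism ::
  "('f, 'r) language \<Rightarrow> ('f, 'r, 'a) fo_struct \<Rightarrow> ('a \<Rightarrow> 'a) \<Rightarrow> bool" where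
  "automorphism L M g \<longleftrightarrow> bij_betw g (univ M) (univ M) \<and>
     (\<forall>f \<in> funs L. \<forall>as \<in> tuples M (fun_arity L f).
        g (fun_int M f as) = fun_int M f (map g as)) \<and>
     (\<forall>r \<in> rels L. \<forall>as \<in> tuples M (rel_arity L r).
        rel_int M r (map g as) \<longleftrightarrow> rel_int M r as)"

definition strongly_homogeneous ::
  "('f, 'r) language \<Rightarrow> 'k rel \<Rightarrow> ('f, 'r, 'a) fo_struct \<Rightarrow> bool" where
  "strongly_homogeneous L \<kappa> M \<longleftrightarrow>
     (\<forall>A h. (card_of A, \<kappa>) \<in> ordLess \<longrightarrow> elementary_map L M A h \<longrightarrow>
        (\<exists>g. automorphism L M g \<and> (\<forall>a \<in> A. g a = h a)))"

text \<open>The cardinality of \<open>formulas L\<close> is that of \<open>L\<close> plus \<open>\<aleph>\<^sub>0\<close>.\<close>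

definition monster_model ::
  "('f, 'r) language \<Rightarrow> ('f, 'r) form set \<Rightarrow> 'k rel \<Rightarrow> ('f, 'r, 'a) fo_struct \<Rightarrow> bool" where
  "monster_model L T \<kappa> U \<longleftrightarrow> is_model L T U \<and>
     Card_order \<kappa> \<and> (card_of (formulas L), \<kappa>) \<in> ordLess \<and>
     saturated L \<kappa> U \<and> strongly_homogeneous L \<kappa> U"


section \<open>Partitioned formulas, SOP and OP\<close>

definition partitioned ::
  "('f, 'r) language \<Rightarrow> ('f, 'r) form \<Rightarrow> nat list \<Rightarrow> nat list \<Rightarrow> bool" where
  "partitioned L \<phi> xs ys \<longleftrightarrow>
     \<phi> \<in> formulas L \<and> distinct (xs @ ys) \<and> free_vars \<phi> \<subseteq> set (xs @ ys)"

definition holds_at ::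
  "('f, 'r, 'a) fo_struct \<Rightarrow> ('f, 'r) form \<Rightarrow> nat list \<Rightarrow> nat list \<Rightarrow> 'a list \<Rightarrow> 'a list \<Rightarrow> bool"
where
  "holds_at M \<phi> xs ys as bs \<longleftrightarrow> sat M (\<lambda>v. the (map_of (zip (xs @ ys) (as @ bs)) v)) \<phi>"

type_synonym 's poset = "'s set \<times> 's rel"

definition formula_SOP ::
  "('f, 'r, 'a) fo_struct \<Rightarrow> 's poset set \<Rightarrow> ('f, 'r) form \<Rightarrow> nat list \<Rightarrow> nat list \<Rightarrow> bool" where
  "formula_SOP U K \<psi> xs ys \<longleftrightarrow>
     (\<forall>(S, le) \<in> K. \<exists>d. (\<forall>s \<in> S. d s \<in> tuples U (length ys)) \<and>
        (\<forall>s\<^sub>0 \<in> S. \<forall>s\<^sub>1 \<in> S.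
           (\<forall>a \<in> tuples U (length xs).
              holds_at U \<psi> xs ys a (d s\<^sub>0) \<longrightarrow> holds_at U \<psi> xs ys a (d s\<^sub>1))
           \<longleftrightarrow> (s\<^sub>0, s\<^sub>1) \<in> le))"

definition has_SOP_class ::
  "('f, 'r) language \<Rightarrow> ('f, 'r, 'a) fo_struct \<Rightarrow> 's poset set \<Rightarrow> bool" where
  "has_SOP_class L U K \<longleftrightarrow> (\<exists>\<psi> xs ys. partitioned L \<psi> xs ys \<and> formula_SOP U K \<psi> xs ys)"

text \<open>Every finite poset is isomorphic to one whose domain is a set of natural numbers.\<close>

definition age :: "'s poset \<Rightarrow> nat poset set" where
  "age \<Sigma> = {(S, le). finite S \<and> partial_order_on S le \<and>
     (\<exists>e. inj_on e S \<and> e ` S \<subseteq> fst \<Sigma> \<and>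
        (\<forall>s \<in> S. \<forall>t \<in> S. (s, t) \<in> le \<longleftrightarrow> (e s, e t) \<in> snd \<Sigma>))}"

definition has_SOP ::
  "('f, 'r) language \<Rightarrow> ('f, 'r, 'a) fo_struct \<Rightarrow> 's poset \<Rightarrow> bool" where
  "has_SOP L U \<Sigma> \<longleftrightarrow> has_SOP_class L U (age \<Sigma>)"

datatype op_elem = Alpha nat | Beta nat

definition Sigma_op :: "op_elem poset" where
  "Sigma_op = (UNIV, Id \<union> {(Alpha i, Beta j) | i j. i < j})"

definition has_OP ::
  "('f, 'r) language \<Rightarrow> ('f, 'r, 'a) fo_struct \<Rightarrow> bool" where
  "has_OP L U \<longleftrightarrow> (\<exists>\<phi> xs ys a b. partitioned L \<phi> xs ys \<and>
     (\<forall>i :: nat. a i \<in> tuples U (length xs)) \<and> (\<forall>j :: nat. b j \<in> tuples U (length ys)) \<and>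
     (\<forall>i j. holds_at U \<phi> xs ys (a i) (b j) \<longleftrightarrow> i < j))"

end

theory Submission
  imports Defs "HOL-Library.Nat_Bijection"
begin

text \<open>
  If \<open>\<psi>(x; y)\<close> has \<open>SOP\<close> for \<open>\<Sigma>\<^sub>o\<^sub>p\<close>, then \<open>\<forall>x (\<psi>(x; y) \<longrightarrow> \<psi>(x; y'))\<close> has arbitrarily long
  finite order patterns, hence an infinite one by saturation. Conversely, let \<open>\<phi>(x; y)\<close> order
  \<open>(a\<^sub>i)\<close> and \<open>(b\<^sub>j)\<close>, and let \<open>\<psi>(x; y, z, z')\<close> be \<open>x = z \<or> (\<phi>(x; y) \<and> z \<noteq> z')\<close>. For indices below \<open>n\<close>,
  represent \<open>\<alpha>\<^sub>i\<close> by the instance of \<open>\<psi>\<close> that defines \<open>{a\<^sub>i}\<close> and \<open>\<beta>\<^sub>j\<close> by the one that defines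
  \<open>\<phi>(\<U>; b\<^sub>j) \<union> {a\<^bsub>n+j\<^esub>}\<close>. The extra point \<open>a\<^bsub>n+j\<^esub>\<close> lies in no other set, which makes the
  \<open>\<beta>\<^sub>j\<close> pairwise incomparable.
\<close>

section \<open>Derived connectives\<close>

definition Conj :: "('f, 'r) form list \<Rightarrow> ('f, 'r) form" where
  "Conj \<phi>s = foldr (\<lambda>\<phi> \<psi>. Neg (Imp \<phi> (Neg \<psi>))) \<phi>s (Neg Falsum)"

definition Foralls :: "nat list \<Rightarrow> ('f, 'r) form \<Rightarrow> ('f, 'r) form" where
  "Foralls vs \<phi> = foldr Forall vs \<phi>"

definition Eqs :: "nat list \<Rightarrow> nat list \<Rightarrow> ('f, 'r) form" where
  "Eqs vs zs = Conj (map2 (\<lambda>v z. Eq (Var v) (Var z)) vs zs)"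

text \<open>Substitution of \<open>zs\<close> for \<open>vs\<close>, with quantifiers and equations so that nothing can be captured.\<close>

definition inst :: "nat list \<Rightarrow> nat list \<Rightarrow> ('f, 'r) form \<Rightarrow> ('f, 'r) form" where
  "inst vs zs \<phi> = Foralls vs (Imp (Eqs vs zs) \<phi>)"

lemma sat_Conj [simp]: "sat M s (Conj \<phi>s) \<longleftrightarrow> (\<forall>\<phi> \<in> set \<phi>s. sat M s \<phi>)"
  unfolding Conj_def by (induction \<phi>s) auto

lemma free_vars_Conj [simp]: "free_vars (Conj \<phi>s) = (\<Union>\<phi> \<in> set \<phi>s. free_vars \<phi>)"
  unfolding Conj_def by (induction \<phi>s) auto

lemma wf_form_Conj [simp]: "wf_form L (Conj \<phi>s) \<longleftrightarrow> (\<forall>\<phi> \<in> set \<phi>s. wf_form L \<phi>)"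
  unfolding Conj_def by (induction \<phi>s) auto

lemma free_vars_Foralls [simp]: "free_vars (Foralls vs \<phi>) = free_vars \<phi> - set vs"
  unfolding Foralls_def by (induction vs) auto

lemma wf_form_Foralls [simp]: "wf_form L (Foralls vs \<phi>) \<longleftrightarrow> wf_form L \<phi>"
  unfolding Foralls_def by (induction vs) auto

text \<open>Quantifying over a whole assignment \<open>s'\<close>, constrained only on
  \<open>vs\<close>, treats the block as one simultaneous quantifier. It also covers lists with
  repetitions: if \<open>v\<close> recurs in the tail, the inner quantifier overwrites the value
  \<open>a\<close> of the outer one.\<close>

lemma sat_Foralls:
  "sat M s (Foralls vs \<phi>) \<longleftrightarrow>
    (\<forall>s'. (\<forall>v. v \<notin> set vs \<longrightarrow> s' v = s v) \<longrightarrow> s' ` set vs \<subseteq> univ M \<longrightarrow> sat M s' \<phi>)"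
proof (induction vs arbitrary: s)
  case Nil
  have "s' = s" if "\<forall>v. s' v = s v" for s' using that by auto
  then show ?case by (auto simp: Foralls_def)
next
  case (Cons v vs)
  have unf: "sat M s (Foralls (v # vs) \<phi>) \<longleftrightarrow> (\<forall>a \<in> univ M. sat M (s(v := a)) (Foralls vs \<phi>))"
    by (simp add: Foralls_def)
  show ?case
  proof
    assume h: "sat M s (Foralls (v # vs) \<phi>)"
    show "\<forall>s'. (\<forall>u. u \<notin> set (v # vs) \<longrightarrow> s' u = s u) \<longrightarrow> s' ` set (v # vs) \<subseteq> univ M \<longrightarrow> sat M s' \<phi>"
    proof (intro allI impI)
      fix s' assume s': "\<forall>u. u \<notin> set (v # vs) \<longrightarrow> s' u = s u" "s' ` set (v # vs) \<subseteq> univ M"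
      then have "sat M (s(v := s' v)) (Foralls vs \<phi>)" using h unf by simp
      then show "sat M s' \<phi>" unfolding Cons.IH using s' by auto
    qed
  next
    assume h: "\<forall>s'. (\<forall>u. u \<notin> set (v # vs) \<longrightarrow> s' u = s u) \<longrightarrow> s' ` set (v # vs) \<subseteq> univ M
      \<longrightarrow> sat M s' \<phi>"
    show "sat M s (Foralls (v # vs) \<phi>)"
      unfolding unf Cons.IH
    proof (intro ballI allI impI)
      fix a s' assume a: "a \<in> univ M" and s': "\<forall>u. u \<notin> set vs \<longrightarrow> s' u = (s(v := a)) u"
        "s' ` set vs \<subseteq> univ M"
      have "s' v \<in> univ M" using a s' by (cases "v \<in> set vs") auto
      then show "sat M s' \<phi>" using h s' by auto
    qed
  qed
qed

lemma sat_Eqs: "length vs = length zs \<Longrightarrow> sat M s (Eqs vs zs) \<longleftrightarrow> map s vs = map s zs"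
  unfolding Eqs_def by (induction vs zs rule: list_induct2) (auto simp: Conj_def)

lemma free_vars_Eqs: "free_vars (Eqs vs zs) \<subseteq> set vs \<union> set zs"
  unfolding Eqs_def by (auto dest: set_zip_leftD set_zip_rightD)

lemma wf_form_Eqs [simp]: "wf_form L (Eqs vs zs)"
  unfolding Eqs_def by auto

lemma wf_form_inst [simp]: "wf_form L (inst vs zs \<phi>) \<longleftrightarrow> wf_form L \<phi>"
  by (simp add: inst_def)

lemma free_vars_inst: "free_vars (inst vs zs \<phi>) \<subseteq> (free_vars \<phi> - set vs) \<union> set zs"
  using free_vars_Eqs[of vs zs] by (auto simp: inst_def)

text \<open>As \<open>zs\<close> avoids \<open>vs\<close>, requantifying \<open>vs\<close> leaves
  the values of \<open>zs\<close> alone. The equations then single out exactly one assignment,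
  \<open>s'\<close>, among those that agree with \<open>s\<close> off \<open>vs\<close>.\<close>

lemma sat_inst:
  assumes "length vs = length zs" "set vs \<inter> set zs = {}" "s ` set zs \<subseteq> univ M"
    and off: "\<And>v. v \<notin> set vs \<Longrightarrow> s' v = s v" and on: "map s' vs = map s zs"
  shows "sat M s (inst vs zs \<phi>) \<longleftrightarrow> sat M s' \<phi>"
proof -
  have same: "map t zs = map s zs" if "\<And>v. v \<notin> set vs \<Longrightarrow> t v = s v" for t
    using assms(2) that by auto
  have eqs: "sat M t (Eqs vs zs) \<longleftrightarrow> map t vs = map s zs" if "\<And>v. v \<notin> set vs \<Longrightarrow> t v = s v" for t
    using sat_Eqs[OF assms(1), of M t] same[of t] that by simp
  have "s' ` set vs = s ` set zs" using on by (metis set_map)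
  then have s': "s' ` set vs \<subseteq> univ M" using assms(3) by simp
  show ?thesis
  proof
    assume "sat M s (inst vs zs \<phi>)"
    then have "sat M s' (Imp (Eqs vs zs) \<phi>)"
      unfolding inst_def sat_Foralls using off s' by blast
    then show "sat M s' \<phi>" using eqs[OF off] on by simp
  next
    assume h: "sat M s' \<phi>"
    have "sat M t \<phi>"
      if t: "\<forall>v. v \<notin> set vs \<longrightarrow> t v = s v" "sat M t (Eqs vs zs)" for t
    proof -
      have "map t vs = map s' vs" using t eqs on by metis
      then have "t = s'" using t(1) off by (metis ext map_eq_conv)
      then show ?thesis using h by simp
    qed
    then show "sat M s (inst vs zs \<phi>)" unfolding inst_def sat_Foralls by simp
  qed
qed

section \<open>Instances of partitioned formulas\<close>

lemma sat_iff_holds_at: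
  assumes "partitioned L \<phi> xs ys"
  shows "sat M s \<phi> \<longleftrightarrow> holds_at M \<phi> xs ys (map s xs) (map s ys)"
  unfolding holds_at_def
proof (rule sat_cong)
  fix v assume "v \<in> free_vars \<phi>"
  then have "v \<in> set (xs @ ys)" using assms by (auto simp: partitioned_def)
  then show "s v = the (map_of (zip (xs @ ys) (map s xs @ map s ys)) v)"
    by (simp only: map_append[symmetric] map_of_zip_map) simp
qed

lemma ex_assignment:
  assumes "distinct vs" "length as = length vs"
  obtains s' where "map s' vs = as" "\<And>v. v \<notin> set vs \<Longrightarrow> s' v = s v"
proof
  let ?s = "\<lambda>v. case map_of (zip vs as) v of Some a \<Rightarrow> a | None \<Rightarrow> s v"
  show "map ?s vs = as"
    by (rule nth_equalityI) (use assms in \<open>auto simp: map_of_zip_nth\<close>)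
  show "?s v = s v" if "v \<notin> set vs" for v
    using that assms by (auto split: option.split dest: map_of_SomeD set_zip_leftD)
qed

section \<open>Realizing formulas in infinitely many variables\<close>

text \<open>With \<open>card_of (formulas L)\<close> below \<open>\<kappa>\<close>, this puts every
  finite parameter set within the reach of saturation.\<close>

lemma infinite_formulas: "infinite (formulas L :: ('f, 'r) form set)"
  unfolding infinite_iff_countable_subset
  by (rule exI[of _ "\<lambda>n. Forall n Falsum"]) (auto simp: inj_def formulas_def)

text \<open>Saturation speaks of finitely many variables, while \<open>\<Gamma>\<close> may use
  infinitely many. This is one step of a construction that fixes their values in turn: if
  \<open>\<Gamma>\<close> is finitely satisfiable with initial values \<open>cs\<close>, one more
  value can be fixed. The type realized for this purpose says of the first \<open>k + 1\<close>
  variables that each finite part of \<open>\<Gamma>\<close> can still be satisfied.\<close>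

lemma realizes_extension:
  fixes U :: "('f, 'r, 'u) fo_struct"
  assumes sat: "saturated L \<kappa> U" and card: "(card_of (set cs), \<kappa>) \<in> ordLess"
    and \<Gamma>: "\<Gamma> \<subseteq> formulas L" and u: "u \<in> univ U" and cs: "set cs \<subseteq> univ U"
    and fin: "\<And>\<Gamma>\<^sub>0. finite \<Gamma>\<^sub>0 \<Longrightarrow> \<Gamma>\<^sub>0 \<subseteq> \<Gamma> \<Longrightarrow>
      \<exists>s. range s \<subseteq> univ U \<and> (\<forall>i < length cs. s i = cs ! i) \<and> (\<forall>\<phi> \<in> \<Gamma>\<^sub>0. sat U s \<phi>)"
  shows "\<exists>a \<in> univ U. \<forall>\<Gamma>\<^sub>0. finite \<Gamma>\<^sub>0 \<longrightarrow> \<Gamma>\<^sub>0 \<subseteq> \<Gamma> \<longrightarrow>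
      (\<exists>s. range s \<subseteq> univ U \<and> (\<forall>i < length (cs @ [a]). s i = (cs @ [a]) ! i) \<and>
        (\<forall>\<phi> \<in> \<Gamma>\<^sub>0. sat U s \<phi>))"
proof -
  define k where "k = length cs"
  have "\<exists>m. \<forall>v \<in> free_vars (Conj \<phi>s). v < m" for \<phi>s :: "('f, 'r) form list"
    using finite_free_vars[of "Conj \<phi>s"] by (meson finite_nat_set_iff_bounded)
  then obtain m where m: "\<And>\<phi>s v. v \<in> free_vars (Conj \<phi>s :: ('f, 'r) form) \<Longrightarrow> v < m \<phi>s" by metis
  \<comment> \<open>An existential statement in primitive connectives: the variables from
    \<open>Suc k\<close> up to the bound \<open>m \<phi>s\<close> can be chosen so that all of
    \<open>\<phi>s\<close> hold. Its free variables are therefore at most \<open>k\<close>.\<close>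
  define E where "E \<phi>s = Neg (Foralls [Suc k..<m \<phi>s] (Neg (Conj \<phi>s)))"
    for \<phi>s :: "('f, 'r) form list"
  \<comment> \<open>The equations pin the first \<open>k\<close> variables of the type to the elements already chosen.\<close>
  define p where "p = {(E \<phi>s, \<lambda>_ :: nat. u) | \<phi>s. set \<phi>s \<subseteq> \<Gamma>} \<union>
    {(Eq (Var i) (Var (Suc k)), \<lambda>_. cs ! i) | i. i < k}"
  have fvE: "v \<le> k" if "v \<in> free_vars (E \<phi>s)" for v \<phi>s
    using that m[of v \<phi>s] by (auto simp: E_def simp del: free_vars_Conj)
  have satE: "sat U s (E \<phi>s) \<longleftrightarrow> (\<exists>s'. (\<forall>v. v \<notin> {Suc k..<m \<phi>s} \<longrightarrow> s' v = s v) \<and>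
      s' ` {Suc k..<m \<phi>s} \<subseteq> univ U \<and> (\<forall>\<phi> \<in> set \<phi>s. sat U s' \<phi>))" for s \<phi>s
    by (auto simp: E_def sat_Foralls)
  have "p \<subseteq> formulas_over L (set cs) (Suc k)"
    proof -
    have "(E \<phi>s, \<lambda>_. u) \<in> formulas_over L (set cs) (Suc k)" if "set \<phi>s \<subseteq> \<Gamma>" for \<phi>s
    proof -
      have "E \<phi>s \<in> formulas L" using that \<Gamma> by (auto simp: E_def formulas_def)
      then show ?thesis using fvE[of _ \<phi>s] by (force simp: formulas_over_def)
    qed
    then show ?thesis by (auto simp: p_def formulas_over_def formulas_def k_def)
  qed
  moreover have "\<exists>as \<in> tuples U (Suc k). realizes U as q" if q: "q \<subseteq> p" "finite q" for q
  proof -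
    \<comment> \<open>Each member of \<open>q\<close> of the form \<open>E \<phi>s\<close> gets a
      list it comes from, and each equation gets the empty list. The union of these lists is a
      finite part of \<open>\<Gamma>\<close>, so a single assignment \<open>s\<close> serves all
      members of \<open>q\<close> at once.\<close>
    have "\<forall>x \<in> q. \<exists>\<phi>s. set \<phi>s \<subseteq> \<Gamma> \<and> (fst x \<in> range E \<longrightarrow> fst x = E \<phi>s)"
    proof
      fix x assume "x \<in> q"
      then consider \<phi>s where "fst x = E \<phi>s" "set \<phi>s \<subseteq> \<Gamma>" | i where "fst x = Eq (Var i) (Var (Suc k))"
        using q by (auto simp: p_def)
      then show "\<exists>\<phi>s. set \<phi>s \<subseteq> \<Gamma> \<and> (fst x \<in> range E \<longrightarrow> fst x = E \<phi>s)"
      proof cases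
        case 2
        then have "fst x \<notin> range E" by (auto simp: E_def)
        then show ?thesis by (intro exI[of _ "[]"]) auto
      qed auto
    qed
    then obtain h where h: "\<And>x. x \<in> q \<Longrightarrow> set (h x) \<subseteq> \<Gamma>"
      "\<And>x. x \<in> q \<Longrightarrow> fst x \<in> range E \<Longrightarrow> fst x = E (h x)" by metis
    obtain s where s: "range s \<subseteq> univ U" "\<forall>i < k. s i = cs ! i"
      "\<forall>\<phi> \<in> (\<Union>x \<in> q. set (h x)). sat U s \<phi>"
    proof -
      have "finite (\<Union>x \<in> q. set (h x))" "(\<Union>x \<in> q. set (h x)) \<subseteq> \<Gamma>" using q(2) h(1) by blast+
      from fin[OF this] show thesis using that unfolding k_def by blast
    qed
    let ?as = "map s [0..<Suc k]"
    have "sat U (\<lambda>v. if v < length ?as then ?as ! v else t v) \<phi>" if x: "(\<phi>, t) \<in> q" for \<phi> t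
    proof -
      have eq: "(\<lambda>v. if v < length ?as then ?as ! v else t v) = (\<lambda>v. if v < Suc k then s v else t v)"
        by (auto simp del: upt_Suc)
      consider (E) "\<phi> \<in> range E" | (eq) i where "i < k" "\<phi> = Eq (Var i) (Var (Suc k))" "t = (\<lambda>_. cs ! i)"
        using x q by (auto simp: p_def)
      then show ?thesis
      proof cases
        case E
        define \<phi>s where "\<phi>s = h (\<phi>, t)"
        have \<phi>: "\<phi> = E \<phi>s" using h(2)[OF x] E by (simp add: \<phi>s_def)
        \<comment> \<open>The witness for the existential block has to agree with the evaluating
          assignment off the block. So it follows \<open>s\<close> on the type variables and below
          the bound \<open>m \<phi>s\<close>, where the formulas are read, and \<open>t\<close>
          elsewhere.\<close>
        let ?s = "\<lambda>v. if v < Suc k \<or> v < m \<phi>s then s v else t v"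
        have "\<forall>\<psi> \<in> set \<phi>s. sat U s \<psi>" using s(3) x by (auto simp: \<phi>s_def)
        then have "sat U s (Conj \<phi>s)" by simp
        moreover have "sat U s (Conj \<phi>s) \<longleftrightarrow> sat U ?s (Conj \<phi>s)"
          by (rule sat_cong) (auto dest: m simp del: free_vars_Conj)
        ultimately have "\<forall>\<psi> \<in> set \<phi>s. sat U ?s \<psi>" by simp
        then show ?thesis unfolding eq \<phi> satE
          by (intro exI[of _ ?s]) (use s(1) in auto)
      next
        case eq
        then show ?thesis using s(2) by (auto simp: nth_append)
      qed
    qed
    then have "realizes U ?as q" unfolding realizes_def by blast
    moreover have "?as \<in> tuples U (Suc k)" using s(1) by (auto simp: tuples_def)
    ultimately show ?thesis by blast
  qed
  ultimately obtain as where as: "as \<in> tuples U (Suc k)" "realizes U as p"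
    using sat[unfolded saturated_def, rule_format, OF cs card] by blast
  have p_sat: "sat U (\<lambda>v. if v < length as then as ! v else t v) \<phi>" if "(\<phi>, t) \<in> p" for \<phi> t
    using bspec[OF as(2)[unfolded realizes_def] that] by simp
  have len: "length as = Suc k" using as by (simp add: tuples_def)
  have "as ! i = cs ! i" if "i < k" for i
  proof -
    have "(Eq (Var i) (Var (Suc k)), \<lambda>_. cs ! i) \<in> p" using that by (auto simp: p_def)
    from p_sat[OF this] show ?thesis using that len by simp
  qed
  then have as_eq: "cs @ [as ! k] = as"
    using len by (intro nth_equalityI) (auto simp: k_def nth_append less_Suc_eq)
  show ?thesis
  proof (rule bexI[of _ "as ! k"], unfold as_eq, intro allI impI)
    show "as ! k \<in> univ U" using as(1) len by (auto simp: tuples_def)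
    fix \<Gamma>\<^sub>0 assume "finite \<Gamma>\<^sub>0" "\<Gamma>\<^sub>0 \<subseteq> \<Gamma>"
    then obtain \<phi>s where \<phi>s: "set \<phi>s = \<Gamma>\<^sub>0" using finite_list by blast
    then have "(E \<phi>s, \<lambda>_. u) \<in> p" using \<open>\<Gamma>\<^sub>0 \<subseteq> \<Gamma>\<close> by (auto simp: p_def)
    from p_sat[OF this] obtain s where s: "\<forall>v. v \<notin> {Suc k..<m \<phi>s} \<longrightarrow> s v = (if v < Suc k then as ! v else u)"
      "s ` {Suc k..<m \<phi>s} \<subseteq> univ U" "\<forall>\<phi> \<in> \<Gamma>\<^sub>0. sat U s \<phi>"
      unfolding satE \<phi>s len by blast
    \<comment> \<open>Beyond the type variables and the quantified block, \<open>s\<close> takes the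
      default \<open>u\<close>, which lies in the universe.\<close>
    have "s v \<in> univ U" for v
      using s(1,2) u as(1) len by (cases "v \<in> {Suc k..<m \<phi>s}") (auto simp: tuples_def)
    moreover have "\<forall>i < length as. s i = as ! i" using s(1) len by auto
    ultimately show "\<exists>s. range s \<subseteq> univ U \<and> (\<forall>i < length as. s i = as ! i) \<and> (\<forall>\<phi> \<in> \<Gamma>\<^sub>0. sat U s \<phi>)"
      using s(3) by blast
  qed
qed

text \<open>Compactness in countably many variables: values are chosen one by one, keeping
  \<open>\<Gamma>\<close> finitely satisfiable over the values so far (\<open>good\<close>). A
  formula has finitely many free variables, so its truth under the limit assignment is settled at a
  finite stage, where \<open>good\<close> applies to that formula alone.\<close>

lemma saturated_realizes_assignment:
  fixes U :: "('f, 'r, 'u) fo_struct"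
  assumes sat: "saturated L \<kappa> U" and card: "\<And>A :: 'u set. finite A \<Longrightarrow> (card_of A, \<kappa>) \<in> ordLess"
    and \<Gamma>: "\<Gamma> \<subseteq> formulas L"
    and fin: "\<And>\<Gamma>\<^sub>0. finite \<Gamma>\<^sub>0 \<Longrightarrow> \<Gamma>\<^sub>0 \<subseteq> \<Gamma> \<Longrightarrow> \<exists>s. range s \<subseteq> univ U \<and> (\<forall>\<phi> \<in> \<Gamma>\<^sub>0. sat U s \<phi>)"
  shows "\<exists>s. range s \<subseteq> univ U \<and> (\<forall>\<phi> \<in> \<Gamma>. sat U s \<phi>)"
proof -
  define good where "good cs \<longleftrightarrow> set cs \<subseteq> univ U \<and> (\<forall>\<Gamma>\<^sub>0. finite \<Gamma>\<^sub>0 \<longrightarrow> \<Gamma>\<^sub>0 \<subseteq> \<Gamma> \<longrightarrow>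
      (\<exists>s. range s \<subseteq> univ U \<and> (\<forall>i < length cs. s i = cs ! i) \<and> (\<forall>\<phi> \<in> \<Gamma>\<^sub>0. sat U s \<phi>)))" for cs
  obtain u where u: "u \<in> univ U" using fin[of "{}"] by auto
  have step: "\<exists>a. good (cs @ [a])" if "good cs" for cs
  proof -
    have "\<exists>a \<in> univ U. \<forall>\<Gamma>\<^sub>0. finite \<Gamma>\<^sub>0 \<longrightarrow> \<Gamma>\<^sub>0 \<subseteq> \<Gamma> \<longrightarrow>
      (\<exists>s. range s \<subseteq> univ U \<and> (\<forall>i < length (cs @ [a]). s i = (cs @ [a]) ! i) \<and>
        (\<forall>\<phi> \<in> \<Gamma>\<^sub>0. sat U s \<phi>))"
      by (rule realizes_extension[OF sat card \<Gamma> u]) (use that in \<open>auto simp: good_def\<close>)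
    then show ?thesis using that unfolding good_def by auto
  qed
  define f where "f = rec_nat [] (\<lambda>_ cs. cs @ [SOME a. good (cs @ [a])])"
  have f0: "f 0 = []" and fS: "f (Suc n) = f n @ [SOME a. good (f n @ [a])]" for n
    by (simp_all add: f_def)
  have good: "good (f n)" for n
  proof (induction n)
    case 0
    show ?case using fin by (simp add: f0 good_def)
  next
    case (Suc n)
    show ?case unfolding fS by (rule someI_ex) (rule step[OF Suc])
  qed
  define s where "s n = (SOME a. good (f n @ [a]))" for n
  have f: "f n = map s [0..<n]" for n
    by (induction n) (simp_all add: f0 fS s_def)
  have "s n \<in> univ U" for n using good[of "Suc n"] by (auto simp: good_def f)
  moreover have "sat U s \<phi>" if "\<phi> \<in> \<Gamma>" for \<phi>
  proof -
    obtain n where n: "\<And>v. v \<in> free_vars \<phi> \<Longrightarrow> v < n"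
      using finite_free_vars[of \<phi>] by (meson finite_nat_set_iff_bounded)
    obtain t where t: "\<forall>i < n. t i = s i" "sat U t \<phi>"
    proof -
      have "\<exists>t. range t \<subseteq> univ U \<and> (\<forall>i < length (f n). t i = f n ! i) \<and> (\<forall>\<psi> \<in> {\<phi>}. sat U t \<psi>)"
        using good[of n] \<open>\<phi> \<in> \<Gamma>\<close> unfolding good_def by blast
      then show thesis using that by (auto simp: f)
    qed
    have "sat U t \<phi> \<longleftrightarrow> sat U s \<phi>" by (rule sat_cong) (use n t in auto)
    then show ?thesis using t by simp
  qed
  ultimately show ?thesis by blast
qed

section \<open>The order property\<close>

text \<open>Each \<open>a i\<close> and \<open>b j\<close> of the infinite pattern becomes a block
  of variables. Finitely many of the conditions \<open>F (i, j)\<close> mention only indices below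
  some \<open>n\<close>, so a pattern of length \<open>n\<close> satisfies them.\<close>

lemma has_OP_if_finite_order_patterns:
  fixes U :: "('f, 'r, 'u) fo_struct"
  assumes sat: "saturated L \<kappa> U" and card: "\<And>A :: 'u set. finite A \<Longrightarrow> (card_of A, \<kappa>) \<in> ordLess"
    and ne: "univ U \<noteq> {}" and part: "partitioned L \<phi> xs ys"
    and patterns: "\<And>n. \<exists>a b. (\<forall>i < n. a i \<in> tuples U (length xs)) \<and>
      (\<forall>j < n. b j \<in> tuples U (length ys)) \<and>
      (\<forall>i < n. \<forall>j < n. holds_at U \<phi> xs ys (a i) (b j) \<longleftrightarrow> i < (j :: nat))"
  shows "has_OP L U"
proof -
  obtain u where u: "u \<in> univ U" using ne by blast
  obtain N where N: "\<And>v. v \<in> set (xs @ ys) \<Longrightarrow> v < N"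
    using finite_nat_set_iff_bounded[of "set (xs @ ys)"] by auto
  \<comment> \<open>Block number \<open>t\<close>: the pairing function keeps distinct blocks
    disjoint, and the offset \<open>N\<close> keeps them apart from \<open>xs @ ys\<close>, as
    \<open>sat_inst\<close> demands. Even blocks hold the left tuples, odd blocks the right
    ones.\<close>
  define z where "z t n = map (\<lambda>l. N + prod_encode (t, l)) [0..<n]" for t n
  define X where "X i = z (2 * i) (length xs)" for i
  define Y where "Y j = z (2 * j + 1) (length ys)" for j
  define I where "I i j = inst (xs @ ys) (X i @ Y j) \<phi>" for i j
  define F where "F = (\<lambda>(i, j). if i < j then I i j else Neg (I i j))"
  have satI: "sat U s (I i j) \<longleftrightarrow> holds_at U \<phi> xs ys (map s (X i)) (map s (Y j))"
    if s: "range s \<subseteq> univ U" for s i j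
  proof -
    have dist: "distinct (xs @ ys)" using part by (simp add: partitioned_def)
    have len: "length (xs @ ys) = length (X i @ Y j)" by (simp add: X_def Y_def z_def)
    obtain s' where s': "map s' (xs @ ys) = map s (X i @ Y j)" "\<And>v. v \<notin> set (xs @ ys) \<Longrightarrow> s' v = s v"
      using ex_assignment[OF dist, of "map s (X i @ Y j)" s] len by auto
    have "set (xs @ ys) \<inter> set (X i @ Y j) = {}"
      using N by (fastforce simp: X_def Y_def z_def)
    then have "sat U s (I i j) \<longleftrightarrow> sat U s' \<phi>"
      unfolding I_def using sat_inst[OF len _ _ s'(2,1)] s by blast
    also have "\<dots> \<longleftrightarrow> holds_at U \<phi> xs ys (map s' xs) (map s' ys)"
      by (rule sat_iff_holds_at[OF part])
    finally show ?thesis using s'(1) by (simp add: X_def Y_def z_def)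
  qed
  have "\<exists>s. range s \<subseteq> univ U \<and> (\<forall>\<phi> \<in> range F. sat U s \<phi>)"
  proof (rule saturated_realizes_assignment[OF sat card])
    show "range F \<subseteq> formulas L"
      using part by (auto simp: F_def I_def formulas_def partitioned_def)
    fix \<Gamma>\<^sub>0 assume "finite \<Gamma>\<^sub>0" "\<Gamma>\<^sub>0 \<subseteq> range F"
    then obtain P where P: "finite P" "\<Gamma>\<^sub>0 = F ` P" by (meson finite_subset_image)
    have "finite (fst ` P \<union> snd ` P)" using P by simp
    then obtain n where n: "\<forall>i \<in> fst ` P \<union> snd ` P. i < n"
      by (meson finite_nat_set_iff_bounded)
    obtain a b where a: "\<forall>i < n. a i \<in> tuples U (length xs)"
      and b: "\<forall>j < n. b j \<in> tuples U (length ys)"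
      and ab: "\<forall>i < n. \<forall>j < n. holds_at U \<phi> xs ys (a i) (b j) \<longleftrightarrow> i < j"
      using patterns[of n] by blast
    define c where "c t = (if even t then a (t div 2) else b (t div 2))" for t
    \<comment> \<open>A variable is decoded into its block and its position there. The default
      \<open>u\<close> covers the positions that the pattern leaves unconstrained, such as those in
      blocks of index at least \<open>n\<close>.\<close>
    define s where "s v = (case prod_decode (v - N) of (t, l) \<Rightarrow>
      if c t ! l \<in> univ U then c t ! l else u)" for v
    have s: "range s \<subseteq> univ U" using u by (auto simp: s_def split: prod.split)
    have "map s (z t k) = c t" if "c t \<in> tuples U k" for t k
      by (rule nth_equalityI) (use that in \<open>auto simp: z_def s_def tuples_def subset_iff\<close>)
    then have "map s (X i) = a i" "map s (Y i) = b i" if "i < n" for i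
      using that a b by (simp_all add: X_def Y_def c_def)
    then have sat_F: "sat U s (F (i, j))" if "i < n" "j < n" for i j
      using that satI[OF s, of i j] ab by (simp add: F_def)
    have "sat U s (F x)" if "x \<in> P" for x
      using sat_F[of "fst x" "snd x"] n that by simp
    then show "\<exists>s. range s \<subseteq> univ U \<and> (\<forall>\<phi> \<in> \<Gamma>\<^sub>0. sat U s \<phi>)" using s P by blast
  qed
  then obtain s where s: "range s \<subseteq> univ U" "\<And>i j. sat U s (F (i, j))" by blast
  have "holds_at U \<phi> xs ys (map s (X i)) (map s (Y j)) \<longleftrightarrow> i < j" for i j
    using s(2)[of i j] satI[OF s(1), of i j] by (simp add: F_def split: if_splits)
  moreover have "map s (X i) \<in> tuples U (length xs)" "map s (Y i) \<in> tuples U (length ys)" for i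
    using s(1) by (auto simp: tuples_def X_def Y_def z_def)
  ultimately show ?thesis using part unfolding has_OP_def
    by (intro exI[of _ \<phi>] exI[of _ xs] exI[of _ ys] exI[of _ "\<lambda>i. map s (X i)"]
        exI[of _ "\<lambda>j. map s (Y j)"]) simp
qed

text \<open>Inclusion between two instances of \<open>\<psi>\<close> is definable by "for all
  \<open>xs\<close>, \<open>\<psi>\<close> implies its copy with \<open>ys'\<close> for
  \<open>ys\<close>", where \<open>ys'\<close> consists of fresh variables.\<close>

lemma ex_inclusion_formula:
  assumes part: "partitioned L \<psi> xs ys"
  obtains \<phi> ys' where "partitioned L \<phi> ys ys'" "length ys' = length ys"
    "\<And>(M :: ('f, 'r, 'a) fo_struct) d d'. d \<in> tuples M (length ys) \<Longrightarrow> d' \<in> tuples M (length ys) \<Longrightarrow>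
      holds_at M (\<phi> :: ('f, 'r) form) ys ys' d d' \<longleftrightarrow>
      (\<forall>a \<in> tuples M (length xs). holds_at M \<psi> xs ys a d \<longrightarrow> holds_at M \<psi> xs ys a d')"
proof -
  obtain N where N: "\<And>v. v \<in> set (xs @ ys) \<Longrightarrow> v < N"
    using finite_nat_set_iff_bounded[of "set (xs @ ys)"] by auto
  define ys' where "ys' = [N..<N + length ys]"
  have len: "length ys = length ys'" by (simp add: ys'_def)
  have disj: "set ys \<inter> set ys' = {}" "set xs \<inter> set ys' = {}"
    using N by (fastforce simp: ys'_def)+
  have dist: "distinct xs" "distinct ys" "distinct ys'" "set xs \<inter> set ys = {}"
    using part by (auto simp: partitioned_def ys'_def)
  define \<phi> where "\<phi> = Foralls xs (Imp \<psi> (inst ys ys' \<psi>))"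
  have part': "partitioned L \<phi> ys ys'"
    using part disj dist free_vars_inst[of ys ys' \<psi>]
    by (auto simp: partitioned_def \<phi>_def formulas_def)
  show thesis
  proof (rule that[OF part' len[symmetric]])
    fix M :: "('f, 'r, 'a) fo_struct" and d d'
    assume d: "d \<in> tuples M (length ys)" "d' \<in> tuples M (length ys)"
    obtain s where "map s (ys @ ys') = d @ d'"
      using ex_assignment[of "ys @ ys'" "d @ d'"] d dist disj len by (auto simp: tuples_def)
    then have s: "map s ys = d" "map s ys' = d'" using d by (auto simp: tuples_def)
    have s_xs: "sat M s' (Imp \<psi> (inst ys ys' \<psi>)) \<longleftrightarrow>
        (holds_at M \<psi> xs ys (map s' xs) d \<longrightarrow> holds_at M \<psi> xs ys (map s' xs) d')"
      if s': "\<forall>v. v \<notin> set xs \<longrightarrow> s' v = s v" for s'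
    proof -
      have ys: "map s' ys = d" "map s' ys' = d'" using s s' dist(4) disj(2) by (auto simp: disjoint_iff intro!: map_cong)
      \<comment> \<open>Moving \<open>d'\<close> from \<open>ys'\<close> to \<open>ys\<close> turns
        the copy of \<open>\<psi>\<close> into \<open>\<psi>\<close> itself; the values of
        \<open>xs\<close> stay.\<close>
      obtain t where t: "map t ys = d'" "\<And>v. v \<notin> set ys \<Longrightarrow> t v = s' v"
        using ex_assignment[of ys d' s'] d dist by (auto simp: tuples_def)
      have "s' ` set ys' \<subseteq> univ M" using ys d by (auto simp: tuples_def)
      from sat_inst[OF len disj(1) this t(2)] have "sat M s' (inst ys ys' \<psi>) \<longleftrightarrow> sat M t \<psi>"
        using t ys by simp
      moreover have "map t xs = map s' xs" using t(2) dist by auto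
      ultimately show ?thesis
        using sat_iff_holds_at[OF part, of M s'] sat_iff_holds_at[OF part, of M t] ys t by simp
    qed
    have "holds_at M \<phi> ys ys' d d' \<longleftrightarrow> sat M s \<phi>"
      using sat_iff_holds_at[OF part', of M s] s by simp
    also have "\<dots> \<longleftrightarrow> (\<forall>a \<in> tuples M (length xs). holds_at M \<psi> xs ys a d \<longrightarrow> holds_at M \<psi> xs ys a d')"
    proof
      assume h: "sat M s \<phi>"
      show "\<forall>a \<in> tuples M (length xs). holds_at M \<psi> xs ys a d \<longrightarrow> holds_at M \<psi> xs ys a d'"
      proof
        fix a assume a: "a \<in> tuples M (length xs)"
        obtain s' where s': "map s' xs = a" "\<And>v. v \<notin> set xs \<Longrightarrow> s' v = s v"
          using ex_assignment[of xs a s] a dist by (auto simp: tuples_def)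
        have "s' ` set xs \<subseteq> univ M" using s' a by (auto simp: tuples_def)
        then have "sat M s' (Imp \<psi> (inst ys ys' \<psi>))"
          using h s' unfolding \<phi>_def sat_Foralls by blast
        then show "holds_at M \<psi> xs ys a d \<longrightarrow> holds_at M \<psi> xs ys a d'" using s_xs[of s'] s' by simp
      qed
    next
      assume h: "\<forall>a \<in> tuples M (length xs). holds_at M \<psi> xs ys a d \<longrightarrow> holds_at M \<psi> xs ys a d'"
      show "sat M s \<phi>"
        unfolding \<phi>_def sat_Foralls
      proof (intro allI impI)
        fix s' assume s': "\<forall>v. v \<notin> set xs \<longrightarrow> s' v = s v" "s' ` set xs \<subseteq> univ M"
        then have "map s' xs \<in> tuples M (length xs)" by (auto simp: tuples_def)
        then show "sat M s' (Imp \<psi> (inst ys ys' \<psi>))" unfolding s_xs[OF s'(1)] using h by blast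
      qed
    qed
    finally show "holds_at M \<phi> ys ys' d d' \<longleftrightarrow>
      (\<forall>a \<in> tuples M (length xs). holds_at M \<psi> xs ys a d \<longrightarrow> holds_at M \<psi> xs ys a d')" .
  qed
qed

text \<open>Members of \<open>age\<close> live on natural numbers, so \<open>Sigma_op\<close> is
  coded by parity: \<open>2 * i\<close> stands for \<open>Alpha i\<close> and
  \<open>2 * i + 1\<close> for \<open>Beta i\<close>. Initial segments with the induced order then
  lie in the age.\<close>

lemma finite_Sigma_op_in_age:
  defines "e \<equiv> \<lambda>k. if even k then Alpha (k div 2) else Beta (k div 2)"
  shows "({..<n}, {(s, t). s < n \<and> t < n \<and> (e s, e t) \<in> snd Sigma_op}) \<in> age Sigma_op"
proof -
  have inj: "s = t" if "e s = e t" for s t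
    using that by (simp add: e_def split: if_splits) presburger+
  have "partial_order_on {..<n} {(s, t). s < n \<and> t < n \<and> (e s, e t) \<in> snd Sigma_op}"
    unfolding partial_order_on_def preorder_on_def
    by (intro conjI refl_onI transI antisymI) (auto simp: Sigma_op_def intro: inj)
  then show ?thesis unfolding age_def
    by (auto simp: Sigma_op_def intro!: exI[of _ e] inj_onI inj)
qed

text \<open>Comparing only alphas on the left with betas on the right, the order of
  \<open>Sigma_op\<close> reads \<open>i < j\<close>. The tuples \<open>d\<close> depend on
  \<open>n\<close>, which is why only finite patterns arise directly.\<close>

lemma has_OP_if_has_SOP:
  fixes U :: "('f, 'r, 'u) fo_struct"
  assumes sat: "saturated L \<kappa> U" and card: "\<And>A :: 'u set. finite A \<Longrightarrow> (card_of A, \<kappa>) \<in> ordLess"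
    and ne: "univ U \<noteq> {}" and SOP: "has_SOP L U Sigma_op"
  shows "has_OP L U"
proof -
  obtain \<psi> xs ys where part: "partitioned L \<psi> xs ys" and \<psi>: "formula_SOP U (age Sigma_op) \<psi> xs ys"
    using SOP by (auto simp: has_SOP_def has_SOP_class_def)
  obtain \<phi> ys' where \<phi>: "partitioned L \<phi> ys ys'" and len: "length ys' = length ys"
    and incl: "\<And>d d'. d \<in> tuples U (length ys) \<Longrightarrow> d' \<in> tuples U (length ys) \<Longrightarrow>
      holds_at U \<phi> ys ys' d d' \<longleftrightarrow>
      (\<forall>a \<in> tuples U (length xs). holds_at U \<psi> xs ys a d \<longrightarrow> holds_at U \<psi> xs ys a d')"
    using ex_inclusion_formula[OF part] by metis
  show ?thesis
  proof (rule has_OP_if_finite_order_patterns[OF sat card ne \<phi>])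
    fix n
    obtain d where d: "\<forall>s \<in> {..<2 * n}. d s \<in> tuples U (length ys)"
      "\<forall>s \<in> {..<2 * n}. \<forall>t \<in> {..<2 * n}.
        (\<forall>a \<in> tuples U (length xs). holds_at U \<psi> xs ys a (d s) \<longrightarrow> holds_at U \<psi> xs ys a (d t)) \<longleftrightarrow>
        ((if even s then Alpha (s div 2) else Beta (s div 2)),
         (if even t then Alpha (t div 2) else Beta (t div 2))) \<in> snd Sigma_op"
      using bspec[OF \<psi>[unfolded formula_SOP_def] finite_Sigma_op_in_age[of "2 * n"]] by auto
    have "holds_at U \<phi> ys ys' (d (2 * i)) (d (2 * j + 1)) \<longleftrightarrow> i < j" if "i < n" "j < n" for i j
    proof -
      have ij: "2 * i \<in> {..<2 * n}" "2 * j + 1 \<in> {..<2 * n}" using that by auto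
      then have "holds_at U \<phi> ys ys' (d (2 * i)) (d (2 * j + 1)) \<longleftrightarrow> (Alpha i, Beta j) \<in> snd Sigma_op"
        using incl d(1) d(2)[rule_format, OF ij] by simp
      then show ?thesis by (simp add: Sigma_op_def)
    qed
    then show "\<exists>a b. (\<forall>i < n. a i \<in> tuples U (length ys)) \<and>
      (\<forall>j < n. b j \<in> tuples U (length ys')) \<and>
      (\<forall>i < n. \<forall>j < n. holds_at U \<phi> ys ys' (a i) (b j) \<longleftrightarrow> i < j)"
      using d(1) by (intro exI[of _ "\<lambda>i. d (2 * i)"] exI[of _ "\<lambda>j. d (2 * j + 1)"]) (simp add: len)
  qed
qed

section \<open>From the order property to \<open>SOP\<close> for \<open>Sigma_op\<close>\<close>

text \<open>The pair \<open>c\<close>, \<open>c'\<close> acts as a switch: \<open>c = c'\<close>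
  turns \<open>\<phi>\<close> off and leaves the singleton of \<open>c\<close>, while
  \<open>c \<noteq> c'\<close> adds the point \<open>c\<close> to the set defined by
  \<open>\<phi>\<close>. Thus one formula defines both kinds of sets.\<close>

lemma ex_switch_formula:
  assumes part: "partitioned L \<phi> xs ys"
  obtains \<psi> zs where "partitioned L \<psi> xs (ys @ zs)" "length zs = 2 * length xs"
    "\<And>(M :: ('f, 'r, 'a) fo_struct) a b c c'. a \<in> tuples M (length xs) \<Longrightarrow> b \<in> tuples M (length ys) \<Longrightarrow>
      c \<in> tuples M (length xs) \<Longrightarrow> c' \<in> tuples M (length xs) \<Longrightarrow>
      holds_at M (\<psi> :: ('f, 'r) form) xs (ys @ zs) a (b @ c @ c') \<longleftrightarrow>
        a = c \<or> (holds_at M \<phi> xs ys a b \<and> c \<noteq> c')"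
proof -
  obtain N where N: "\<And>v. v \<in> set (xs @ ys) \<Longrightarrow> v < N"
    using finite_nat_set_iff_bounded[of "set (xs @ ys)"] by auto
  define k where "k = length xs"
  define zs where "zs = [N..<N + k]"
  define zs' where "zs' = [N + k..<N + 2 * k]"
  have len: "length zs = length xs" "length zs' = length xs" by (simp_all add: zs_def zs'_def k_def)
  have dist: "distinct (xs @ ys @ zs @ zs')"
    using part N by (fastforce simp: partitioned_def zs_def zs'_def)
  define \<psi> where "\<psi> = Imp (Neg (Eqs xs zs)) (Conj [\<phi>, Neg (Eqs zs zs')])"
  have part': "partitioned L \<psi> xs (ys @ zs @ zs')"
    using part dist free_vars_Eqs[of xs zs] free_vars_Eqs[of zs zs']
    by (auto simp: partitioned_def \<psi>_def formulas_def)
  show thesis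
  proof (rule that[OF part'])
    show "length (zs @ zs') = 2 * length xs" using len by simp
    fix M :: "('f, 'r, 'a) fo_struct" and a b c c'
    assume t: "a \<in> tuples M (length xs)" "b \<in> tuples M (length ys)"
      "c \<in> tuples M (length xs)" "c' \<in> tuples M (length xs)"
    obtain s where "map s (xs @ ys @ zs @ zs') = a @ b @ c @ c'"
      using ex_assignment[OF dist, of "a @ b @ c @ c'"] t len by (auto simp: tuples_def)
    then have s: "map s xs = a" "map s ys = b" "map s zs = c" "map s zs' = c'"
      using t len by (auto simp: tuples_def)
    show "holds_at M \<psi> xs (ys @ zs @ zs') a (b @ c @ c') \<longleftrightarrow>
        a = c \<or> (holds_at M \<phi> xs ys a b \<and> c \<noteq> c')"
      using sat_iff_holds_at[OF part', of M s] sat_iff_holds_at[OF part, of M s] s len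
      by (auto simp: \<psi>_def sat_Eqs)
  qed
qed

lemma has_SOP_if_has_OP:
  fixes U :: "('f, 'r, 'u) fo_struct"
  assumes "has_OP L U"
  shows "has_SOP L U Sigma_op"
proof -
  obtain \<phi> xs ys a b where part: "partitioned L \<phi> xs ys"
    and a': "\<forall>i :: nat. a i \<in> tuples U (length xs)" and b': "\<forall>j :: nat. b j \<in> tuples U (length ys)"
    and ab': "\<forall>i j. holds_at U \<phi> xs ys (a i) (b j) \<longleftrightarrow> i < j"
    using assms unfolding has_OP_def by (elim exE conjE)
  note a = a'[rule_format] and b = b'[rule_format] and ab = ab'[rule_format]
  \<comment> \<open>For \<open>i < j\<close>, the tuple \<open>b j\<close> separates them:
    \<open>\<phi>\<close> holds at \<open>a i\<close> and fails at \<open>a j\<close>.\<close>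
  have a_inj: "a i = a j \<longleftrightarrow> i = j" for i j
    using ab[of i j] ab[of j j] ab[of j i] ab[of i i] by (cases i j rule: linorder_cases) auto
  obtain \<psi> zs where \<psi>: "partitioned L \<psi> xs (ys @ zs)" and len: "length zs = 2 * length xs"
    and sw: "\<And>x y c c'. x \<in> tuples U (length xs) \<Longrightarrow> y \<in> tuples U (length ys) \<Longrightarrow>
      c \<in> tuples U (length xs) \<Longrightarrow> c' \<in> tuples U (length xs) \<Longrightarrow>
      holds_at U \<psi> xs (ys @ zs) x (y @ c @ c') \<longleftrightarrow> x = c \<or> (holds_at U \<phi> xs ys x y \<and> c \<noteq> c')"
    using ex_switch_formula[OF part] by metis
  have "formula_SOP U (age Sigma_op) \<psi> xs (ys @ zs)"
    unfolding formula_SOP_def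
  proof (intro ballI, clarify)
    fix S le assume "(S, le) \<in> age Sigma_op"
    then obtain e where S: "finite S"
      and e: "\<And>s t. s \<in> S \<Longrightarrow> t \<in> S \<Longrightarrow> (s, t) \<in> le \<longleftrightarrow> (e s, e t) \<in> snd Sigma_op"
      by (auto simp: age_def)
    define idx where "idx = (\<lambda>x. case x of Alpha i \<Rightarrow> i | Beta i \<Rightarrow> i)"
    have "finite ((idx \<circ> e) ` S)" using S by simp
    \<comment> \<open>Past all indices in use, the tuples \<open>a (n + j)\<close> differ from every
      \<open>a i\<close> that represents an alpha, and no \<open>b j'\<close> with
      \<open>j' < n\<close> is related to them.\<close>
    then obtain n where n: "\<And>s. s \<in> S \<Longrightarrow> idx (e s) < n"
      unfolding finite_nat_set_iff_bounded by auto
    \<comment> \<open>In the alpha case \<open>b 0\<close> is a placeholder, because the equal last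
      two entries switch \<open>\<phi>\<close> off. In the beta case \<open>a (Suc (n + j))\<close>
      serves only to differ from \<open>a (n + j)\<close>.\<close>
    define D where "D = (\<lambda>x. case x of Alpha i \<Rightarrow> b 0 @ a i @ a i
      | Beta j \<Rightarrow> b j @ a (n + j) @ a (Suc (n + j)))"
    define In where "In x y \<longleftrightarrow> holds_at U \<psi> xs (ys @ zs) x (D y)" for x y
    have In_Alpha: "In x (Alpha i) \<longleftrightarrow> x = a i" if "x \<in> tuples U (length xs)" for x i
      using sw[OF that b a a, of 0 i i] by (simp add: In_def D_def)
    have In_Beta: "In x (Beta j) \<longleftrightarrow> x = a (n + j) \<or> holds_at U \<phi> xs ys x (b j)"
      if "x \<in> tuples U (length xs)" for x j
      using sw[OF that b a a, of j "n + j" "Suc (n + j)"] by (simp add: In_def D_def a_inj)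
    have D: "D x \<in> tuples U (length (ys @ zs))" for x
      using a b len by (auto simp: D_def tuples_def split: op_elem.split)
    have sub: "(\<forall>x \<in> tuples U (length xs). In x p \<longrightarrow> In x q) \<longleftrightarrow> (p, q) \<in> snd Sigma_op"
      if pq: "idx p < n" "idx q < n" for p q
    proof (cases p)
      case (Alpha i)
      \<comment> \<open>The set of an alpha is a singleton, so inclusion is membership of
        \<open>a i\<close>. In the set of \<open>Beta j\<close> this means \<open>i < j\<close>,
        since \<open>i = n + j\<close> is excluded by the bound on indices.\<close>
      then have "(\<forall>x \<in> tuples U (length xs). In x p \<longrightarrow> In x q) \<longleftrightarrow> In (a i) q"
        using a by (metis In_Alpha)
      then show ?thesis using pq Alpha
        by (cases q) (auto simp: a ab In_Alpha In_Beta a_inj Sigma_op_def idx_def)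
    next
      case (Beta j)
      have "In (a (n + j)) p" by (simp add: Beta In_Beta a)
      \<comment> \<open>The private point of \<open>Beta j\<close> lies in no other set: it is too
        late in the sequence to satisfy \<open>\<phi>\<close> with any \<open>b j'\<close> in use.
        Hence betas are maximal.\<close>
      moreover have "In (a (n + j)) q \<longleftrightarrow> p = q"
        using pq Beta by (cases q) (auto simp: a ab In_Alpha In_Beta a_inj idx_def)
      ultimately have "(\<forall>x \<in> tuples U (length xs). In x p \<longrightarrow> In x q) \<longleftrightarrow> p = q"
        using a[of "n + j"] by auto
      then show ?thesis using Beta by (auto simp: Sigma_op_def)
    qed
    show "\<exists>d. (\<forall>s \<in> S. d s \<in> tuples U (length (ys @ zs))) \<and>
      (\<forall>s\<^sub>0 \<in> S. \<forall>s\<^sub>1 \<in> S. (\<forall>x \<in> tuples U (length xs).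
        holds_at U \<psi> xs (ys @ zs) x (d s\<^sub>0) \<longrightarrow> holds_at U \<psi> xs (ys @ zs) x (d s\<^sub>1)) \<longleftrightarrow> (s\<^sub>0, s\<^sub>1) \<in> le)"
      using D e sub[unfolded In_def] n by (intro exI[of _ "\<lambda>s. D (e s)"]) simp
  qed
  then show ?thesis using \<psi> unfolding has_SOP_def has_SOP_class_def by blast
qed

theorem theorem2p2:
  fixes L :: "('f, 'r) language"
    and T :: "('f, 'r) form set"
    and \<kappa> :: "'k rel"
    and U :: "('f, 'r, 'u) fo_struct"
  assumes "complete_theory L T"
    and "monster_model L T \<kappa> U"
  shows "has_SOP L U Sigma_op \<longleftrightarrow> has_OP L U"
proof
  \<comment> \<open>The monster model gives a cardinal above that of \<open>formulas L\<close>,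
    which is infinite, and so above every finite cardinal.\<close>
  have "(card_of A, \<kappa>) \<in> ordLess" if "finite A" for A :: "'u set"
  proof -
    have "(card_of A, card_of (formulas L)) \<in> ordLess"
      using finite_ordLess_infinite[OF card_of_Well_order card_of_Well_order] that infinite_formulas
      by (metis Field_card_of)
    then show ?thesis using assms(2) ordLess_transitive unfolding monster_model_def by blast
  qed
  moreover have "saturated L \<kappa> U" "univ U \<noteq> {}"
    using assms(2) by (auto simp: monster_model_def is_model_def is_struct_def)
  moreover assume "has_SOP L U Sigma_op"
  ultimately show "has_OP L U" using has_OP_if_has_SOP by blast
qed (rule has_SOP_if_has_OP)

end
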